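(* There is a positive constant $c$ such that for infinitely many positive integers $n$, $$h(n)\le \frac{n}{4}-c\log\log n .$$
   Context: All graphs are finite and simple; $d_G(u,v)$ denotes the shortest-path distance between $u$ and $v$ in $G$. For $S\subseteq V(G)$, the distance multiset $D(S)$ is the multiset $\{d_G(u,v): \{u,v\}\subseteq S,\ u\neq v\}$ of pairwise distances between vertices of $S$. Two vertex sets $S_1,S_2\subseteq V(G)$ are homometric if $D(S_1)=D(S_2)$. For a graph $G$, $h(G)$ is the largest integer $h$ such that there exist two disjoint homometric sets $S_1,S_2\subseteq V(G)$ with $|S_1|=|S_2|=h$. For a positive integer $n$, $h(n)=\min\{h(G): G \text{ is a graph on } n \text{ vertices}\}$. *)

theory Defs
  imports Complex_Main "HOL-Library.Multiset" "Graph_Theory.Graph_Theory"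
begin

(* Finite simple graphs are the locale pair_graph: finite, loop-free, symmetric digraphs
   whose arcs are ordered pairs of vertices, so that an edge {u,v} is the pair of arcs
   (u,v), (v,u).  Vertices u, v in different components have distance \<infinity>. *)
definition graph_dist :: "'a pair_pre_digraph \<Rightarrow> 'a \<Rightarrow> 'a \<Rightarrow> ereal" where
  "graph_dist G u v = wf_digraph.\<mu> (with_proj G) (\<lambda>_. 1) u v"

(* The condition u < v on an arbitrary linear order of the vertices selects each unordered
   pair {u,v} exactly once; see count_dist_mset below. *)
definition dist_mset :: "('a::linorder) pair_pre_digraph \<Rightarrow> 'a set \<Rightarrow> ereal multiset" where
  "dist_mset G S = image_mset (\<lambda>(u, v). graph_dist G u v)
     (mset_set {(u, v). u \<in> S \<and> v \<in> S \<and> u < v})"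

definition homometric :: "('a::linorder) pair_pre_digraph \<Rightarrow> 'a set \<Rightarrow> 'a set \<Rightarrow> bool" where
  "homometric G S T \<longleftrightarrow> dist_mset G S = dist_mset G T"

definition hom_sizes :: "('a::linorder) pair_pre_digraph \<Rightarrow> nat set" where
  "hom_sizes G = {h. \<exists>S T. S \<subseteq> pverts G \<and> T \<subseteq> pverts G \<and> S \<inter> T = {} \<and>
     homometric G S T \<and> card S = h \<and> card T = h}"

definition hom_graph :: "('a::linorder) pair_pre_digraph \<Rightarrow> nat" where
  "hom_graph G = Max (hom_sizes G)"

(* Every finite graph is isomorphic to one whose vertices are natural numbers. *)
definition hom_num :: "nat \<Rightarrow> nat" where
  "hom_num n = Min {hom_graph G | G :: nat pair_pre_digraph. pair_graph G \<and> card (pverts G) = n}"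

lemma graph_dist_sym:
  assumes "pair_graph G"
  shows "graph_dist G u v = graph_dist G v u"
proof -
  interpret pair_graph G by fact
  have le: "graph_dist G a b \<le> graph_dist G b a" for a b
    unfolding graph_dist_def \<mu>_def
  proof (rule INF_mono)
    fix p assume "p \<in> {p. awalk b p a}"
    then have "awalk a (rev_path p) b" by simp
    moreover have "awalk_cost (\<lambda>_. 1) (rev_path p) = awalk_cost (\<lambda>_. 1) p"
      by (induction p) (auto simp: awalk_cost_def)
    ultimately show "\<exists>q\<in>{p. awalk a p b}. ereal (awalk_cost (\<lambda>_. 1) q) \<le> ereal (awalk_cost (\<lambda>_. 1) p)"
      by (intro bexI[of _ "rev_path p"]) auto
  qed
  show ?thesis by (intro antisym le)
qed

lemma count_dist_mset:
  assumes "pair_graph G" "finite S"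
  shows "count (dist_mset G S) d =
    card {e. \<exists>u v. e = {u, v} \<and> e \<subseteq> S \<and> u \<noteq> v \<and> graph_dist G u v = d}"
proof -
  let ?P = "{(u, v). u \<in> S \<and> v \<in> S \<and> u < v}"
  let ?A = "{x \<in> ?P. (\<lambda>(u, v). graph_dist G u v) x = d}"
  let ?B = "{e. \<exists>u v. e = {u, v} \<and> e \<subseteq> S \<and> u \<noteq> v \<and> graph_dist G u v = d}"
  have fin: "finite ?P"
    by (rule finite_subset[of _ "S \<times> S"]) (use assms in auto)
  have "bij_betw (\<lambda>(u, v). {u, v}) ?A ?B"
    unfolding bij_betw_def
  proof
    show "inj_on (\<lambda>(u, v). {u, v}) ?A"
      by (auto simp: inj_on_def doubleton_eq_iff)
    show "(\<lambda>(u, v). {u, v}) ` ?A = ?B"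
    proof (intro equalityI subsetI)
      fix e assume "e \<in> ?B"
      then obtain u v where e: "e = {u, v}" "e \<subseteq> S" "u \<noteq> v" "graph_dist G u v = d" by blast
      then have "(min u v, max u v) \<in> ?A" "e = {min u v, max u v}"
        using graph_dist_sym[OF assms(1), of u v] by (auto simp: min_def max_def)
      then show "e \<in> (\<lambda>(u, v). {u, v}) ` ?A"
        by (intro image_eqI[of _ _ "(min u v, max u v)"]) auto
    qed force
  qed
  then have "card ?A = card ?B" by (rule bij_betw_same_card)
  moreover have "count (dist_mset G S) d = card ?A"
    unfolding dist_mset_def count_image_mset
    using fin by (auto simp: sum.If_cases Int_def vimage_def intro!: arg_cong[of _ _ card])
  ultimately show ?thesis by simp
qed

(* The extrema defining hom_graph and hom_num range over finite nonempty sets. *)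
lemma hom_sizes_bounds:
  assumes "finite (pverts G)"
  shows "finite (hom_sizes G)" "0 \<in> hom_sizes G" "hom_sizes G \<subseteq> {..card (pverts G)}"
proof -
  show sub: "hom_sizes G \<subseteq> {..card (pverts G)}"
    using card_mono[OF assms] by (auto simp: hom_sizes_def)
  then show "finite (hom_sizes G)" by (rule finite_subset) simp
  show "0 \<in> hom_sizes G"
    unfolding hom_sizes_def by (auto simp: homometric_def intro!: exI[of _ "{}"])
qed

lemma hom_num_set:
  fixes n :: nat
  defines "H \<equiv> {hom_graph G | G :: nat pair_pre_digraph. pair_graph G \<and> card (pverts G) = n}"
  shows "finite H" "H \<noteq> {}"
proof -
  have "hom_graph G \<le> n" if "pair_graph G" "card (pverts G) = n" for G :: "nat pair_pre_digraph"
  proof -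
    have fin: "finite (pverts G)"
      using that(1) by (simp add: pair_graph_def pair_digraph_def pair_fin_digraph_def
          pair_fin_digraph_axioms_def)
    show ?thesis
      unfolding hom_graph_def
      using Max_in[of "hom_sizes G"] hom_sizes_bounds[OF fin] that(2) by blast
  qed
  then have "H \<subseteq> {..n}" by (auto simp: H_def)
  then show "finite H" by (rule finite_subset) simp
  let ?G = "\<lparr>pverts = {..<n}, parcs = {}\<rparr>"
  have "pair_graph ?G"
    by unfold_locales (auto simp: symmetric_def arcs_ends_def sym_def)
  then show "H \<noteq> {}"
    unfolding H_def by (auto intro!: exI[of _ "?G"])
qed

end

theory Submission
  imports Defs
begin

(* The extremal graph is a complete multipartite graph on m vertices with L odd classes of
   rapidly increasing sizes, together with a path of k vertices whose first vertex is joined to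
   all m vertices.  If two homometric sets reach far into the path, the one containing the last
   path vertex must lie in the path and the other one has at most one vertex outside it, so that
   2 h \<le> k + 1.  Otherwise both sets lie in the multipartite part and the first two path vertices,
   and counting the pairs at distance 2 shows that at least L vertices are lost, so that
   2 h + L \<le> m + 2.  Taking k = m + 1 - L makes h about n/4 - L/4, and class sizes of the form
   (2 L + 3)^(3^i) make log log n linear in L. *)

section \<open>Distances and distance classes\<close>

text \<open>A certificate for distances to a fixed target \<open>v\<close>: \<open>arc\<close>
  forces every walk from \<open>u\<close> to \<open>v\<close> to have length at least
  \<open>D u\<close>, while following \<open>descent\<close> yields a walk of exactly that
  length.\<close>

lemma graph_dist_eq:
  assumes "pair_graph G" "v \<in> pverts G" "u \<in> pverts G"
    and target: "D v = (0::nat)"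
    and arc: "\<And>u w. (u, w) \<in> parcs G \<Longrightarrow> D u \<le> D w + 1"
    and descent: "\<And>u. u \<in> pverts G \<Longrightarrow> u \<noteq> v \<Longrightarrow> \<exists>w. (u, w) \<in> parcs G \<and> D u = D w + 1"
  shows "graph_dist G u v = ereal (real (D u))"
proof -
  interpret pair_graph G by fact
  have lower: "real (D u) \<le> awalk_cost (\<lambda>_. 1) p" if "awalk u p v" for u p
    using that
  proof (induction p arbitrary: u)
    case Nil
    then show ?case by (simp add: awalk_Nil_iff target)
  next
    case (Cons e p)
    then have e: "e \<in> parcs G" "u = fst e" "awalk (snd e) p v"
      by (auto simp: awalk_Cons_iff)
    with Cons.IH arc[of "fst e" "snd e"] show ?case by fastforce
  qed
  have upper: "\<exists>p. awalk u p v \<and> awalk_cost (\<lambda>_. 1) p = real (D u)" if "u \<in> pverts G" for u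
    using that
  proof (induction "D u" arbitrary: u rule: less_induct)
    case less
    show ?case
    proof (cases "u = v")
      case True
      with less.prems show ?thesis
        by (intro exI[of _ "[]"]) (simp add: awalk_Nil_iff target)
    next
      case False
      with descent less.prems obtain w where w: "(u, w) \<in> parcs G" "D u = D w + 1" by blast
      moreover have "w \<in> pverts G" using w(1) in_arcsD2 by blast
      ultimately obtain p where "awalk w p v" "awalk_cost (\<lambda>_. 1) p = real (D w)"
        using less.hyps by auto
      with w less.prems show ?thesis
        by (intro exI[of _ "(u, w) # p"]) (auto simp: awalk_Cons_iff)
    qed
  qed
  obtain p where p: "awalk u p v" "awalk_cost (\<lambda>_. 1) p = real (D u)"
    using upper assms(3) by blast
  show ?thesis
    unfolding graph_dist_def \<mu>_def
  proof (rule antisym)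
    show "(INF p\<in>{p. awalk u p v}. ereal (awalk_cost (\<lambda>_. 1) p)) \<le> ereal (real (D u))"
      using p by (intro INF_lower2[of p]) auto
    show "ereal (real (D u)) \<le> (INF p\<in>{p. awalk u p v}. ereal (awalk_cost (\<lambda>_. 1) p))"
      by (rule INF_greatest) (use lower in auto)
  qed
qed

definition pairs_at :: "('a \<Rightarrow> 'a \<Rightarrow> nat) \<Rightarrow> 'a set \<Rightarrow> nat \<Rightarrow> 'a set set" where
  "pairs_at D S d = {e. \<exists>u v. e = {u, v} \<and> e \<subseteq> S \<and> u \<noteq> v \<and> D u v = d}"

lemma finite_pairs_at: "finite S \<Longrightarrow> finite (pairs_at D S d)"
  by (rule finite_subset[of _ "Pow S"]) (auto simp: pairs_at_def)

lemma pairs_at_eqI: "u \<in> S \<Longrightarrow> v \<in> S \<Longrightarrow> u \<noteq> v \<Longrightarrow> D u v = d \<Longrightarrow> {u, v} \<in> pairs_at D S d"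
  unfolding pairs_at_def by blast

text \<open>Passes from multisets of \<open>ereal\<close> distances to counts of unordered pairs at
  a natural distance, the only form in which homometry is used later.\<close>

lemma card_pairs_at_homometric:
  assumes "pair_graph G" "homometric G S T" "S \<subseteq> pverts G" "T \<subseteq> pverts G"
    and dist: "\<And>u v. u \<in> pverts G \<Longrightarrow> v \<in> pverts G \<Longrightarrow> graph_dist G u v = ereal (real (D u v))"
  shows "card (pairs_at D S d) = card (pairs_at D T d)"
proof -
  interpret pair_graph G by fact
  have "card (pairs_at D X d) = count (dist_mset G X) (ereal (real d))" if "X \<subseteq> pverts G" for X
  proof -
    have "finite X" using that pair_finite_verts finite_subset by blast
    have "pairs_at D X d =
      {e. \<exists>u v. e = {u, v} \<and> e \<subseteq> X \<and> u \<noteq> v \<and> graph_dist G u v = ereal (real d)}"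
      unfolding pairs_at_def
      by (intro Collect_cong ex_cong1 conj_cong refl) (use that in \<open>auto simp: dist subset_iff\<close>)
    with count_dist_mset[OF assms(1) \<open>finite X\<close>] show ?thesis by simp
  qed
  with assms show ?thesis by (simp add: homometric_def)
qed

section \<open>The graph\<close>

(* The vertices below m carry a complete multipartite graph with classes given by q;
   the vertices m, ..., m + k - 1 form the path, and m is joined to everything below m. *)
locale tailed_multipartite =
  fixes m k :: nat and q :: "nat \<Rightarrow> nat"
  assumes k_pos: "k \<ge> 1"
begin

definition adj :: "nat \<Rightarrow> nat \<Rightarrow> bool" where
  "adj u v \<longleftrightarrow> (if u < m then (if v < m then q u \<noteq> q v else v = m)
     else (if v < m then u = m else u = Suc v \<or> v = Suc u))"

definition graph :: "nat pair_pre_digraph" where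
  "graph = \<lparr>pverts = {..<m + k}, parcs = {(u, v). u < m + k \<and> v < m + k \<and> adj u v}\<rparr>"

text \<open>Two vertices of one class meet through \<open>m\<close>. Between the multipartite part
  and the path every route passes \<open>m\<close>, whence the extra 1 in \<open>Suc v - m\<close>.
  On the path, truncated subtraction makes \<open>(u - v) + (v - u)\<close> the absolute
  difference.\<close>

definition D :: "nat \<Rightarrow> nat \<Rightarrow> nat" where
  "D u v = (if u < m then (if v < m then (if u = v then 0 else if q u = q v then 2 else 1) else Suc v - m)
     else (if v < m then Suc u - m else (u - v) + (v - u)))"

lemma pverts_graph [simp]: "pverts graph = {..<m + k}"
  by (simp add: graph_def)

lemma pair_graph_graph: "pair_graph graph"
proof
  show "finite (parcs graph)"
    by (rule finite_subset[of _ "{..<m + k} \<times> {..<m + k}"]) (auto simp: graph_def)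
qed (auto split: if_splits simp: graph_def adj_def symmetric_def arcs_ends_def arc_to_ends_def sym_def)

lemma graph_dist_graph:
  assumes "u < m + k" "v < m + k"
  shows "graph_dist graph u v = ereal (real (D u v))"
proof (rule graph_dist_eq[OF pair_graph_graph])
  show "v \<in> pverts graph" "u \<in> pverts graph" using assms by auto
  show "D v v = 0" by (simp add: D_def)
  show "D u v \<le> D w v + 1" if "(u, w) \<in> parcs graph" for u w
  proof -
    have "adj u w" using that by (simp add: graph_def)
    then show ?thesis
      unfolding adj_def D_def by (cases "u < m"; cases "w < m"; cases "v < m") auto
  qed
  show "\<exists>w. (u, w) \<in> parcs graph \<and> D u v = D w v + 1" if "u \<in> pverts graph" "u \<noteq> v" for u
  proof -
    \<comment> \<open>The next vertex on a shortest path from \<open>u\<close> to \<open>v\<close>;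
      \<open>k_pos\<close> guarantees that \<open>m\<close> is a vertex.\<close>
    let ?w = "if u < m then (if v < m \<and> q u \<noteq> q v then v else m)
      else if u < v then u + 1 else if v < m \<and> u = m then v else u - 1"
    have "?w < m + k \<and> adj u ?w \<and> D u v = D ?w v + 1"
      using that assms k_pos unfolding adj_def D_def
      by (cases "u < m"; cases "v < m"; cases "u < v") auto
    with that show ?thesis by (intro exI[of _ ?w]) (auto simp: graph_def)
  qed
qed

section \<open>Pairs of sets that reach far into the path\<close>

text \<open>\<open>Suc p - m\<close> is the distance from \<open>p\<close> to any vertex below
  \<open>m\<close>. As it is at least 3, it exceeds the 2 inside a class as well, so no pair below
  \<open>p\<close> can imitate it.\<close>

lemma D_less:
  assumes "u < p" "v < p" "m + 2 \<le> p"
  shows "D u v < Suc p - m"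
  using assms by (auto simp: D_def)

text \<open>\<open>D_less\<close> confines \<open>S\<close> to the path. There its largest distance
  is attained only once, which limits the vertices of \<open>T\<close> below \<open>m\<close>. The
  alternative \<open>h \<le> 3\<close> absorbs the case where \<open>T\<close> stops before
  \<open>m + 2\<close>.\<close>

lemma far_pair:
  assumes S: "S \<subseteq> {..<m + k}" and T: "T \<subseteq> {..<m + k}" and disj: "S \<inter> T = {}"
    and card: "card S = h" "card T = h"
    and pairs: "\<And>d. card (pairs_at D S d) = card (pairs_at D T d)"
    and p: "p \<in> S" "m + 2 \<le> p" "\<And>x. x \<in> S \<union> T \<Longrightarrow> x \<le> p"
  shows "h \<le> 3 \<or> 2 * h \<le> k + 1"
proof (cases "T = {}")
  case True
  with card show ?thesis by simp
next
  case False
  have fin: "finite S" "finite T" using S T finite_subset by blast+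
  have same_empty: "pairs_at D S d = {} \<longleftrightarrow> pairs_at D T d = {}" for d
    using pairs[of d] fin by (metis card_0_eq finite_pairs_at)
  have T_less: "x < p" if "x \<in> T" for x
    using that p disj by (metis IntI UnI2 empty_iff le_neq_implies_less)
  have S_path: "m \<le> x" if "x \<in> S" for x
  proof (rule ccontr)
    assume "\<not> m \<le> x"
    with that p have "{x, p} \<in> pairs_at D S (Suc p - m)"
      by (intro pairs_at_eqI) (auto simp: D_def)
    then have "pairs_at D T (Suc p - m) \<noteq> {}" using same_empty by blast
    then obtain u v where "u \<in> T" "v \<in> T" "D u v = Suc p - m"
      unfolding pairs_at_def by blast
    with D_less[of u p v] T_less p show False by simp
  qed
  define t where "t = Max T"
  have t: "t \<in> T" "\<And>x. x \<in> T \<Longrightarrow> x \<le> t" using False fin by (auto simp: t_def)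
  define a where "a = Min S"
  have a: "a \<in> S" "\<And>x. x \<in> S \<Longrightarrow> a \<le> x" using p fin by (auto simp: a_def intro!: Min_in)
  have D_S: "D a p = p - a"
    using S_path[OF a(1)] a(2)[OF p(1)] p(2) by (auto simp: D_def)
  have "D u v \<le> max 2 (Suc t - m)" if "u \<in> T" "v \<in> T" for u v
    using t(2)[OF that(1)] t(2)[OF that(2)] by (auto simp: D_def)
  then have "pairs_at D T d = {}" if "d > max 2 (Suc t - m)" for d
    using that unfolding pairs_at_def by fastforce
  then have "pairs_at D S d = {}" if "d > max 2 (Suc t - m)" for d
    using that same_empty by blast
  \<comment> \<open>Every distance in \<open>S\<close> occurs in \<open>T\<close>, so the spread of
    \<open>S\<close> obeys the diameter bound of \<open>T\<close>.\<close>
  then have diam: "p - a \<le> max 2 (Suc t - m)"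
    using D_S a p pairs_at_eqI[of a S p D "p - a"] by (cases "a = p") (auto simp: not_le[symmetric])
  show ?thesis
  proof (cases "m + 2 \<le> t")
    \<comment> \<open>Here all distances in \<open>T\<close> are at most 2, so \<open>S\<close> fits
      into three consecutive path vertices.\<close>
    case False
    then have "p - a \<le> 2" using diam by auto
    then have "S \<subseteq> {a..a + 2}" using a p by fastforce
    then have "card S \<le> card {a..a + 2}" by (intro card_mono) auto
    with card show ?thesis by simp
  next
    case True
    \<comment> \<open>By \<open>diam\<close> this distance is at least the whole spread of
      \<open>S\<close>, so only the two extreme vertices can realise it.\<close>
    have "pairs_at D S (Suc t - m) \<subseteq> {{a, p}}"
    proof
      fix e assume "e \<in> pairs_at D S (Suc t - m)"
      then obtain u v where e: "e = {u, v}" "u \<in> S" "v \<in> S" "u \<noteq> v" "D u v = Suc t - m"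
        by (auto simp: pairs_at_def)
      have "a \<le> u" "a \<le> v" "u \<le> p" "v \<le> p" "m \<le> u" "m \<le> v" using e a p S_path by auto
      moreover have "p - a \<le> Suc t - m" using diam True by auto
      moreover have "u - v + (v - u) = Suc t - m"
        using e(5) \<open>m \<le> u\<close> \<open>m \<le> v\<close> by (simp add: D_def)
      ultimately have "u = a \<and> v = p \<or> u = p \<and> v = a"
        using e(4) by linarith
      with e show "e \<in> {{a, p}}" by auto
    qed
    then have "card (pairs_at D S (Suc t - m)) \<le> card {{a, p}}" by (rule card_mono[rotated]) simp
    then have le1: "card (pairs_at D T (Suc t - m)) \<le> 1" using pairs by simp
    \<comment> \<open>Each vertex of \<open>T\<close> below \<open>m\<close> forms with
      \<open>t\<close> its own pair at distance \<open>Suc t - m\<close>.\<close>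
    have "card (T \<inter> {..<m}) = card ((\<lambda>x. {x, t}) ` (T \<inter> {..<m}))"
      using True by (intro card_image[symmetric]) (auto simp: inj_on_def doubleton_eq_iff)
    also have "\<dots> \<le> card (pairs_at D T (Suc t - m))"
    proof (intro card_mono finite_pairs_at fin subsetI)
      fix e assume "e \<in> (\<lambda>x. {x, t}) ` (T \<inter> {..<m})"
      then obtain x where "x \<in> T" "x < m" "e = {x, t}" by auto
      then show "e \<in> pairs_at D T (Suc t - m)"
        using t True by (auto intro!: pairs_at_eqI simp: D_def)
    qed
    finally have T1: "card (T \<inter> {..<m}) \<le> 1" using le1 by simp
    have "S \<union> T \<subseteq> {m..<m + k} \<union> (T \<inter> {..<m})"
      using S T S_path by auto
    then have "card (S \<union> T) \<le> card ({m..<m + k} \<union> (T \<inter> {..<m}))"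
      using fin by (intro card_mono) auto
    also have "\<dots> \<le> k + 1" using card_Un_le[of "{m..<m + k}" "T \<inter> {..<m}"] T1 by simp
    finally show ?thesis using card_Un_disjoint[OF fin disj] card by simp
  qed
qed

section \<open>Pairs of sets close to the multipartite part\<close>

text \<open>Below \<open>m + 2\<close>, distance 2 occurs only inside a class or between
  \<open>m + 1\<close> and a vertex below \<open>m\<close>, because \<open>m\<close> is adjacent to
  all the others. Doubling clears the binomial coefficients.\<close>

lemma card_pairs_at_2:
  assumes S: "S \<subseteq> {..<m + 2}" and q: "\<And>v. v < m \<Longrightarrow> q v < L"
  defines "s \<equiv> \<lambda>i. card {v \<in> S. v < m \<and> q v = i}"
  shows "2 * int (card (pairs_at D S 2)) =
    (\<Sum>i<L. int (s i) * (int (s i) - 1)) + (if m + 1 \<in> S then 2 * (\<Sum>i<L. int (s i)) else 0)"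
proof -
  define P where "P i = {v \<in> S. v < m \<and> q v = i}" for i
  define A where "A i = {e. e \<subseteq> P i \<and> card e = 2}" for i
  define B where "B = (if m + 1 \<in> S then (\<lambda>x. {x, m + 1}) ` (S \<inter> {..<m}) else {})"
  have fin: "finite S" "finite (P i)" "finite (A i)" "finite B" for i
  proof -
    show f: "finite S" using S finite_subset by blast
    then show "finite (P i)" "finite B" by (auto simp: P_def B_def)
    then show "finite (A i)" by (simp add: A_def)
  qed
  have "pairs_at D S 2 = (\<Union>i<L. A i) \<union> B"
  proof (intro equalityI subsetI)
    fix e assume "e \<in> pairs_at D S 2"
    then obtain u v where e: "e = {u, v}" "u \<in> S" "v \<in> S" "u \<noteq> v" "D u v = 2"
      by (auto simp: pairs_at_def)
    have "u < m + 2" "v < m + 2" using e(2,3) S by auto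
    with e(4,5) have "u < m \<and> v < m \<and> q u = q v \<or> u < m \<and> v = m + 1 \<or> v < m \<and> u = m + 1"
      unfolding D_def by (cases "u < m"; cases "v < m") (auto split: if_splits)
    then show "e \<in> (\<Union>i<L. A i) \<union> B"
    proof (elim disjE)
      assume "u < m \<and> v < m \<and> q u = q v"
      then have "e \<in> A (q u)" "q u < L" using e q by (auto simp: A_def P_def)
      then show ?thesis by blast
    next
      assume "u < m \<and> v = m + 1"
      then have "e \<in> B" using e by (auto simp: B_def)
      then show ?thesis by blast
    next
      assume "v < m \<and> u = m + 1"
      then have "e \<in> B" using e by (auto simp: B_def)
      then show ?thesis by blast
    qed
  next
    fix e assume "e \<in> (\<Union>i<L. A i) \<union> B"
    then consider i where "e \<in> A i" | "e \<in> B" by auto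
    then show "e \<in> pairs_at D S 2"
    proof cases
      case 1
      then obtain u v where "e = {u, v}" "u \<noteq> v" by (auto simp: A_def card_2_iff)
      with 1 show ?thesis by (auto simp: A_def P_def D_def intro!: pairs_at_eqI)
    next
      case 2
      then obtain x where "x \<in> S" "x < m" "e = {x, m + 1}" "m + 1 \<in> S"
        by (auto simp: B_def split: if_splits)
      then show ?thesis by (simp add: pairs_at_eqI D_def)
    qed
  qed
  moreover have "(\<Union>i<L. A i) \<inter> B = {}" by (auto simp: A_def B_def P_def)
  ultimately have "card (pairs_at D S 2) = card (\<Union>i<L. A i) + card B"
    using fin by (simp add: card_Un_disjoint)
  also have "card (\<Union>i<L. A i) = (\<Sum>i<L. card (A i))"
  proof (rule card_UN_disjoint)
    show "\<forall>i\<in>{..<L}. \<forall>j\<in>{..<L}. i \<noteq> j \<longrightarrow> A i \<inter> A j = {}"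
    proof (intro ballI impI equals0I)
      fix i j e assume "i \<noteq> j" and e: "e \<in> A i \<inter> A j"
      then have "e \<noteq> {}" by (auto simp: A_def)
      with e \<open>i \<noteq> j\<close> show False by (auto simp: A_def P_def)
    qed
  qed (use fin in auto)
  also have "(\<Sum>i<L. card (A i)) = (\<Sum>i<L. s i choose 2)"
    using fin by (simp add: A_def n_subsets s_def P_def)
  also have "card B = (if m + 1 \<in> S then (\<Sum>i<L. s i) else 0)"
  proof (cases "m + 1 \<in> S")
    case True
    have "card B = card (S \<inter> {..<m})"
      using True by (auto simp: B_def inj_on_def doubleton_eq_iff intro!: card_image)
    also have "S \<inter> {..<m} = (\<Union>i<L. P i)" using q by (auto simp: P_def)
    also have "card \<dots> = (\<Sum>i<L. card (P i))"
      by (rule card_UN_disjoint) (use fin in \<open>auto simp: P_def\<close>)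
    finally show ?thesis using True by (simp add: s_def P_def)
  qed (simp add: B_def)
  finally have *: "int (card (pairs_at D S 2)) =
    (\<Sum>i<L. int (s i choose 2)) + (if m + 1 \<in> S then (\<Sum>i<L. int (s i)) else 0)"
    by simp
  have "2 * int (n choose 2) = int n * (int n - 1)" for n
    by (induction n) (auto simp: numeral_2_eq_2 algebra_simps)
  then show ?thesis unfolding * by (auto simp: sum_distrib_left distrib_left)
qed

end

text \<open>As with uniqueness of digit expansions, a nonzero top entry contributes at least
  \<open>c L\<close>, more than all lower terms can cancel. Hence the entries vanish from the top
  down.\<close>

lemma rapid_combination_zero:
  fixes c x B :: "nat \<Rightarrow> int"
  assumes "(\<Sum>i<L. c i * x i) = 0"
    and "\<And>i. i < L \<Longrightarrow> \<bar>x i\<bar> \<le> B i"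
    and "\<And>i. i < L \<Longrightarrow> (\<Sum>j<i. c j * B j) < c i"
    and "\<And>i. i < L \<Longrightarrow> 0 \<le> c i"
  shows "i < L \<Longrightarrow> x i = 0"
  using assms
proof (induction L arbitrary: i)
  case (Suc L)
  have "\<bar>\<Sum>j<L. c j * x j\<bar> \<le> (\<Sum>j<L. c j * B j)"
    using Suc.prems(3,5)
    by (intro order_trans[OF sum_abs] sum_mono) (auto simp: abs_mult intro!: mult_left_mono)
  also have "\<dots> < c L" using Suc.prems by simp
  finally have less: "\<bar>c L * x L\<bar> < c L" using Suc.prems(2) by simp
  have "x L = 0"
  proof (rule ccontr)
    assume "x L \<noteq> 0"
    then have "c L * 1 \<le> c L * \<bar>x L\<bar>" using Suc.prems(5)[of L] by (intro mult_left_mono) auto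
    with less Suc.prems(5)[of L] show False by (simp add: abs_mult)
  qed
  moreover from this have "j < L \<Longrightarrow> x j = 0" for j
    using Suc.prems by (intro Suc.IH) auto
  ultimately show ?case using Suc.prems(1) less_Suc_eq by auto
qed simp

(* Comparing the numbers of pairs at distance 2 gives an equation of the form
   sum_i (s_i + t_i - 1) (s_i - t_i) = 0, or sum_i (s_i + t_i) (s_i - t_i + 1) = 0 when the
   second path vertex lies in S.  Its coefficients grow so fast that every difference is
   determined: in the first case s_i = t_i, which wastes a vertex of every odd class; in the
   second case t_i = s_i + 1 for all i, which contradicts card S = card T. *)
lemma (in tailed_multipartite) near_pair:
  assumes S: "S \<subseteq> {..<m + 2}" and T: "T \<subseteq> {..<m + 2}" and disj: "S \<inter> T = {}"
    and card: "card S = h" "card T = h"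
    and pairs: "card (pairs_at D S 2) = card (pairs_at D T 2)"
    and path: "m + 1 \<notin> T" and L: "L \<ge> 3"
    and q: "\<And>v. v < m \<Longrightarrow> q v < L"
    and parts: "\<And>i. i < L \<Longrightarrow> card {v. v < m \<and> q v = i} = a i"
    and odd: "\<And>i. i < L \<Longrightarrow> odd (a i)"
    and growth: "\<And>i. i < L \<Longrightarrow> (\<Sum>j<i. a j * (a j + 1)) + L < a i"
  shows "2 * h + L \<le> m + 2"
proof (rule ccontr)
  assume contra: "\<not> 2 * h + L \<le> m + 2"
  define P where "P X i = {v \<in> X. v < m \<and> q v = i}" for X i
  define s t where "s i = int (card (P S i))" and "t i = int (card (P T i))" for i
  have fin: "finite S" "finite T" using S T finite_subset by blast+
  have sum_P: "(\<Sum>i<L. card (P X i)) = card (X \<inter> {..<m})" if "finite X" for X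
  proof -
    have "X \<inter> {..<m} = (\<Union>i<L. P X i)" using q by (auto simp: P_def)
    also have "card \<dots> = (\<Sum>i<L. card (P X i))"
      by (rule card_UN_disjoint) (use that in \<open>auto simp: P_def\<close>)
    finally show ?thesis by simp
  qed
  have "m = (\<Sum>i<L. a i)"
  proof -
    have "(\<Sum>i<L. a i) = (\<Sum>i<L. card (P {..<m} i))"
      using parts by (intro sum.cong) (auto simp: P_def)
    then show ?thesis using sum_P[of "{..<m}"] by simp
  qed
  then have m: "int m = (\<Sum>i<L. int (a i))" by simp
  have st_le: "s i + t i \<le> int (a i)" if "i < L" for i
  proof -
    have "card (P S i) + card (P T i) = card (P S i \<union> P T i)"
      using fin disj by (intro card_Un_disjoint[symmetric]) (auto simp: P_def)
    also have "\<dots> \<le> card {v. v < m \<and> q v = i}"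
      by (intro card_mono) (auto simp: P_def)
    finally show ?thesis using parts[OF that] by (simp add: s_def t_def)
  qed
  have card_X: "int (card X) = (\<Sum>i<L. int (card (P X i))) + int (card (X - {..<m}))"
    if "finite X" for X
  proof -
    have "card X = card (X \<inter> {..<m}) + card (X - {..<m})"
      using that by (subst card_Un_disjoint[symmetric]) (auto intro!: arg_cong[of _ _ card])
    then show ?thesis using sum_P[OF that] by (metis of_nat_add of_nat_sum)
  qed
  have h: "int h = (\<Sum>i<L. s i) + int (card (S - {..<m}))"
    "int h = (\<Sum>i<L. t i) + int (card (T - {..<m}))"
    using card_X[OF fin(1)] card_X[OF fin(2)] card by (simp_all add: s_def t_def)
  have rest: "card (S - {..<m}) + card (T - {..<m}) \<le> 2"
  proof -
    have "card (S - {..<m}) + card (T - {..<m}) = card ((S - {..<m}) \<union> (T - {..<m}))"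
      using fin disj by (intro card_Un_disjoint[symmetric]) auto
    also have "\<dots> \<le> card {m..<m + 2}" using S T by (intro card_mono) auto
    finally show ?thesis by simp
  qed
  \<comment> \<open>At most two of the \<open>2 * h\<close> chosen vertices lie on the path, so
    under \<open>contra\<close> fewer than \<open>L\<close> vertices of the classes remain
    unchosen.\<close>
  have missing: "(\<Sum>i<L. int (a i) - s i - t i) < int L"
    using contra h rest m by (simp add: sum_subtractf)
  have st_ge: "int (a i) - int L < s i + t i" if "i < L" for i
  proof -
    have "int (a i) - s i - t i \<le> (\<Sum>i<L. int (a i) - s i - t i)"
      using that st_le by (intro member_le_sum) (auto simp: algebra_simps)
    with missing show ?thesis by simp
  qed
  have nonneg: "0 \<le> s i" "0 \<le> t i" for i by (simp_all add: s_def t_def)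
  \<comment> \<open>Stated to serve both cases: \<open>c\<close> may be \<open>s i + t i - 1\<close>
    or \<open>s i + t i\<close>, and the bound \<open>a i + 1\<close> leaves room for the shift in
    \<open>s i - t i + 1\<close>.\<close>
  have rapid: "x i = 0" if "i < L" "(\<Sum>i<L. c i * x i) = 0"
    and c: "\<And>i. i < L \<Longrightarrow> s i + t i - 1 \<le> c i \<and> c i \<le> s i + t i"
    and x: "\<And>i. i < L \<Longrightarrow> \<bar>x i\<bar> \<le> int (a i) + 1" for c x :: "nat \<Rightarrow> int" and i
  proof (rule rapid_combination_zero[where B = "\<lambda>i. int (a i) + 1", OF that(2) x _ _ that(1)])
    fix i assume i: "i < L"
    have "(\<Sum>j<i. c j * (int (a j) + 1)) \<le> (\<Sum>j<i. int (a j) * (int (a j) + 1))"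
    proof (intro sum_mono mult_right_mono)
      fix j assume "j \<in> {..<i}"
      with c[of j] st_le[of j] i show "c j \<le> int (a j)" by force
    qed simp
    also have "\<dots> = int (\<Sum>j<i. a j * (a j + 1))" by (simp add: algebra_simps)
    also have "\<dots> < int (a i) - int L" using growth[OF i] by linarith
    \<comment> \<open>Strictness in \<open>st_ge\<close> compensates for the possible
      \<open>- 1\<close> in \<open>c i\<close>.\<close>
    also have "\<dots> \<le> c i" using c[OF i] st_ge[OF i] by linarith
    finally show "(\<Sum>j<i. c j * (int (a j) + 1)) < c i" .
    show "0 \<le> c i"
      using c[OF i] st_ge[OF i] growth[OF i] by linarith
  qed
  have count: "(\<Sum>i<L. s i * (s i - 1)) + (if m + 1 \<in> S then 2 * (\<Sum>i<L. s i) else 0) =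
      (\<Sum>i<L. t i * (t i - 1))"
    using card_pairs_at_2[OF S q] card_pairs_at_2[OF T q] pairs path
    by (simp add: s_def t_def P_def)
  show False
  proof (cases "m + 1 \<in> S")
    case True
    have "(\<Sum>i<L. (s i + t i) * (s i - t i + 1)) =
        (\<Sum>i<L. s i * (s i - 1) + 2 * s i - t i * (t i - 1))"
      by (intro sum.cong) (auto simp: algebra_simps)
    also have "\<dots> = 0" using count True by (simp add: sum_subtractf sum.distrib sum_distrib_left)
    finally have sum_zero: "(\<Sum>i<L. (s i + t i) * (s i - t i + 1)) = 0" .
    have "s i - t i + 1 = 0" if "i < L" for i
    proof (rule rapid[OF that sum_zero])
      fix j assume "j < L"
      with st_le[of j] nonneg[of j] show "\<bar>s j - t j + 1\<bar> \<le> int (a j) + 1" by linarith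
    qed auto
    then have "(\<Sum>i<L. t i) = (\<Sum>i<L. s i + 1)" by (intro sum.cong) fastforce+
    \<comment> \<open>To equalise the cardinalities, \<open>S\<close> would need at least
      \<open>L\<close> path vertices, but by \<open>rest\<close> only two are available and
      \<open>L\<close> is at least 3.\<close>
    then have "(\<Sum>i<L. t i) = (\<Sum>i<L. s i) + int L" by (simp add: sum.distrib)
    with h rest L show False by linarith
  next
    case False
    have "(\<Sum>i<L. (s i + t i - 1) * (s i - t i)) =
        (\<Sum>i<L. s i * (s i - 1) - t i * (t i - 1))"
      by (intro sum.cong) (auto simp: algebra_simps)
    also have "\<dots> = 0" using count False by (simp add: sum_subtractf)
    finally have sum_zero: "(\<Sum>i<L. (s i + t i - 1) * (s i - t i)) = 0" .
    have eq: "s i - t i = 0" if "i < L" for i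
    proof (rule rapid[OF that sum_zero])
      fix j assume "j < L"
      with st_le[of j] nonneg[of j] show "\<bar>s j - t j\<bar> \<le> int (a j) + 1" by linarith
    qed auto
    have "(\<Sum>i<L. 1) \<le> (\<Sum>i<L. int (a i) - s i - t i)"
    proof (rule sum_mono)
      fix i assume "i \<in> {..<L}"
      then have i: "i < L" by simp
      \<comment> \<open>Equal shares cannot exhaust an odd class, so each of the \<open>L\<close>
        classes loses a vertex, against \<open>missing\<close>.\<close>
      have "int (a i) \<noteq> s i + t i"
      proof
        assume "int (a i) = s i + t i"
        then have "int (a i) = 2 * s i" using eq[OF i] by simp
        then have "even (int (a i))" by simp
        with odd[OF i] show False by simp
      qed
      with st_le[OF i] show "1 \<le> int (a i) - s i - t i" by simp
    qed
    with missing show False by simp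
  qed
qed

text \<open>With \<open>k + L = m + 1\<close> the far bound \<open>k + 1\<close> and the near bound
  \<open>m + 2 - L\<close> on twice the size coincide. The condition \<open>k \<ge> 5\<close>
  settles the exceptional sizes up to 3.\<close>

lemma (in tailed_multipartite) hom_graph_le:
  assumes L: "L \<ge> 3"
    and q: "\<And>v. v < m \<Longrightarrow> q v < L"
    and parts: "\<And>i. i < L \<Longrightarrow> card {v. v < m \<and> q v = i} = a i"
    and odd: "\<And>i. i < L \<Longrightarrow> odd (a i)"
    and growth: "\<And>i. i < L \<Longrightarrow> (\<Sum>j<i. a j * (a j + 1)) + L < a i"
    and k: "k + L = m + 1" "k \<ge> 5"
  shows "2 * hom_graph graph + L \<le> m + 2"
proof -
  have fin: "finite (pverts graph)" by simp
  have "hom_graph graph \<in> hom_sizes graph"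
    unfolding hom_graph_def using hom_sizes_bounds[OF fin] by (intro Max_in) auto
  then obtain S T where ST: "S \<subseteq> pverts graph" "T \<subseteq> pverts graph" "S \<inter> T = {}"
    "homometric graph S T" "card S = hom_graph graph" "card T = hom_graph graph"
    by (auto simp: hom_sizes_def)
  have pairs: "card (pairs_at D S d) = card (pairs_at D T d)" for d
    using ST graph_dist_graph by (intro card_pairs_at_homometric[OF pair_graph_graph]) auto
  have finST: "finite S" "finite T" using ST finite_subset fin by blast+
  show ?thesis
  proof (cases "S \<union> T \<subseteq> {..<m + 2}")
    case True
    show ?thesis
    \<comment> \<open>By disjointness one of the sets avoids \<open>m + 1\<close>; it takes the role
      of \<open>T\<close> in \<open>near_pair\<close>.\<close>
    proof (cases "m + 1 \<in> T")
      case False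
      with True ST pairs show ?thesis
        by (intro near_pair[OF _ _ _ _ _ _ _ L q parts odd growth, of S T]) auto
    next
      case T: True
      with True ST pairs show ?thesis
        by (intro near_pair[OF _ _ _ _ _ _ _ L q parts odd growth, of T S]) auto
    qed
  next
    case False
    define p where "p = Max (S \<union> T)"
    have p: "p \<in> S \<union> T" "\<And>x. x \<in> S \<union> T \<Longrightarrow> x \<le> p"
      using False finST Max_in[of "S \<union> T"] by (auto simp: p_def)
    with False have p2: "m + 2 \<le> p" by fastforce
    have "hom_graph graph \<le> 3 \<or> 2 * hom_graph graph \<le> k + 1"
    proof (cases "p \<in> S")
      case True
      with ST pairs p p2 show ?thesis by (intro far_pair[of S T _ p]) auto
    next
      case False
      with ST pairs p p2 show ?thesis by (intro far_pair[of T S _ p]) auto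
    qed
    with k show ?thesis by linarith
  qed
qed

section \<open>Choice of the parameters\<close>

text \<open>The classes are consecutive intervals; each induction step appends one at the
  end.\<close>

lemma ex_classes:
  fixes a :: "nat \<Rightarrow> nat"
  shows "\<exists>q. (\<forall>v<(\<Sum>i<L. a i). q v < L) \<and>
    (\<forall>i<L. card {v. v < (\<Sum>i<L. a i) \<and> q v = i} = a i)"
proof (induction L)
  case (Suc L)
  let ?m = "\<Sum>i<L. a i"
  from Suc obtain q where q: "\<And>v. v < ?m \<Longrightarrow> q v < L"
    "\<And>i. i < L \<Longrightarrow> card {v. v < ?m \<and> q v = i} = a i" by blast
  let ?q = "\<lambda>v. if v < ?m then q v else L"
  have "card {v. v < ?m + a L \<and> ?q v = i} = a i" if "i < Suc L" for i
  proof (cases "i = L")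
    case True
    then have "{v. v < ?m + a L \<and> ?q v = i} = {?m..<?m + a L}"
      using q(1) by (auto split: if_splits) (metis less_irrefl not_le)
    then show ?thesis using True by simp
  next
    case False
    then have "{v. v < ?m + a L \<and> ?q v = i} = {v. v < ?m \<and> q v = i}"
      by (auto split: if_splits)
    then show ?thesis using False that q(2) by simp
  qed
  moreover have "?q v < Suc L" if "v < ?m + a L" for v using q(1)[of v] by auto
  ultimately show ?case by (intro exI[of _ ?q]) auto
qed simp

text \<open>Each size is the cube of the previous one, and all are odd because the base is. The base
  depends on \<open>L\<close> so that the growth condition holds already for the first
  class.\<close>

definition class_size :: "nat \<Rightarrow> nat \<Rightarrow> nat" where
  "class_size L i = (2 * L + 3) ^ (3 ^ i)"

text \<open>With \<open>a\<close> the size at \<open>i\<close>, the induction hypothesis bounds the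
  next left side by \<open>a^2 + 2 * a\<close>, which lies below \<open>a^3\<close> since
  \<open>a\<close> is at least 3.\<close>

lemma class_size_growth: "(\<Sum>j<i. class_size L j * (class_size L j + 1)) + L < class_size L i"
proof (induction i)
  case (Suc i)
  let ?a = "class_size L i"
  have "2 * L + 3 \<le> ?a" by (auto simp: class_size_def intro: self_le_power)
  then have "3 * (?a * ?a) \<le> ?a * (?a * ?a)" "3 * ?a \<le> ?a * ?a"
    by (intro mult_right_mono; simp)+
  moreover have "(\<Sum>j<Suc i. class_size L j * (class_size L j + 1)) + L < ?a * ?a + 2 * ?a"
    using Suc by simp
  moreover have "class_size L (Suc i) = ?a * (?a * ?a)"
    by (simp add: class_size_def power_mult mult.commute[of 3] power3_eq_cube)
  ultimately show ?case using \<open>2 * L + 3 \<le> ?a\<close> by linarith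
qed (simp add: class_size_def)

text \<open>This is \<open>m + k\<close> for \<open>m\<close> the total class size and
  \<open>k = m + 1 - L\<close>.\<close>

definition order_for :: "nat \<Rightarrow> nat" where
  "order_for L = 2 * (\<Sum>i<L. class_size L i) + 1 - L"

text \<open>A crude bound that keeps the truncated subtraction in \<open>order_for\<close> exact and
  makes the orders unbounded.\<close>

lemma sum_class_size_ge: "L * (2 * L + 3) \<le> (\<Sum>i<L. class_size L i)"
proof -
  have "(\<Sum>i<L. 2 * L + 3) \<le> (\<Sum>i<L. class_size L i)"
    by (intro sum_mono) (auto simp: class_size_def intro: self_le_power)
  then show ?thesis by simp
qed

lemma hom_num_order_for:
  assumes "L \<ge> 3"
  shows "4 * real (hom_num (order_for L)) \<le> real (order_for L) + 3 - real L"
proof -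
  define m where "m = (\<Sum>i<L. class_size L i)"
  define k where "k = m + 1 - L"
  have "L * 9 \<le> L * (2 * L + 3)" using assms by (intro mult_left_mono) auto
  with sum_class_size_ge[of L] have m: "9 * L \<le> m" unfolding m_def by linarith
  then have k: "k + L = m + 1" "k \<ge> 5" and order: "order_for L = m + k"
    using assms by (auto simp: k_def order_for_def m_def)
  obtain q where q: "\<And>v. v < m \<Longrightarrow> q v < L"
    "\<And>i. i < L \<Longrightarrow> card {v. v < m \<and> q v = i} = class_size L i"
    using ex_classes[of "class_size L" L] unfolding m_def by blast
  interpret tailed_multipartite m k q by standard (use k in simp)
  have "2 * hom_graph graph + L \<le> m + 2"
    by (rule hom_graph_le[OF assms q _ class_size_growth k]) (auto simp: class_size_def)
  moreover have "hom_num (order_for L) \<le> hom_graph graph"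
    unfolding hom_num_def
    by (rule Min_le[OF hom_num_set(1)]) (use pair_graph_graph order in auto)
  ultimately show ?thesis using k order by linarith
qed

text \<open>The growth condition at index \<open>L\<close> bounds the total class size by
  \<open>class_size L L\<close>, so the order is at most \<open>?A ^ (3 ^ L + 1)\<close>; two
  logarithms leave a linear term.\<close>

lemma ln_ln_order_for:
  assumes "L \<ge> 3"
  shows "ln (ln (real (order_for L))) \<le> 8 * real L"
proof -
  let ?A = "2 * L + 3"
  have "(\<Sum>i<L. class_size L i) \<le> (\<Sum>i<L. class_size L i * (class_size L i + 1))"
    by (intro sum_mono) simp
  also have "\<dots> < class_size L L" using class_size_growth[of L L] by simp
  finally have "order_for L \<le> 2 * class_size L L" by (simp add: order_for_def)
  also have "\<dots> \<le> ?A ^ (3 ^ L + 1)" by (simp add: class_size_def)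
  finally have "real (order_for L) \<le> real (?A ^ (3 ^ L + 1))" by (rule of_nat_mono)
  then have upper: "real (order_for L) \<le> real ?A ^ (3 ^ L + 1)" by (simp only: of_nat_power)
  have "L * 9 \<le> L * (2 * L + 3)" using assms by (intro mult_left_mono) auto
  with sum_class_size_ge[of L] assms have lower: "order_for L \<ge> 3"
    unfolding order_for_def by linarith
  have "ln (real (order_for L)) \<le> ln (real ?A ^ (3 ^ L + 1))"
    using upper lower by (intro ln_mono) auto
  also have "\<dots> = real (3 ^ L + 1) * ln (real ?A)" by (rule ln_realpow)
  also have "\<dots> \<le> 3 ^ (L + 1) * real ?A"
  proof (rule mult_mono)
    show "ln (real ?A) \<le> real ?A" by (rule less_imp_le, rule ln_less_self) simp
    have "(1::real) \<le> 3 ^ L" by (rule one_le_power) simp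
    moreover have "real (3 ^ L + 1) = 3 ^ L + 1" "(3::real) ^ (L + 1) = 3 * 3 ^ L" by simp_all
    ultimately show "real (3 ^ L + 1) \<le> 3 ^ (L + 1)" by linarith
  qed auto
  finally have *: "ln (real (order_for L)) \<le> 3 ^ (L + 1) * real ?A" .
  have "0 < ln (real (order_for L))" using lower by simp
  then have "ln (ln (real (order_for L))) \<le> ln (3 ^ (L + 1) * real ?A)"
    using * by (intro ln_mono) auto
  also have "\<dots> = real (L + 1) * ln 3 + ln (real ?A)"
    by (simp add: ln_mult ln_realpow distrib_right)
  also have "\<dots> \<le> real (L + 1) * 2 + real (2 * L + 2)"
  proof (intro add_mono mult_left_mono)
    show "ln (3::real) \<le> 2" using ln_le_minus_one[of "3::real"] by simp
    show "ln (real ?A) \<le> real (2 * L + 2)" using ln_le_minus_one[of "real ?A"] by simp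
  qed simp
  also have "\<dots> \<le> 8 * real L" using assms by simp
  finally show ?thesis .
qed

theorem theorem2:
  shows "\<exists>c::real. c > 0 \<and>
    infinite {n::nat. n > 0 \<and> real (hom_num n) \<le> real n / 4 - c * ln (ln (real n))}"
proof (intro exI[of _ "1 / 64"] conjI)
  let ?N = "{n::nat. n > 0 \<and> real (hom_num n) \<le> real n / 4 - 1 / 64 * ln (ln (real n))}"
  show "infinite ?N"
    unfolding infinite_nat_iff_unbounded_le
  proof
    fix b :: nat
    \<comment> \<open>For \<open>L\<close> at least 6 the gain \<open>(L - 3) / 4\<close> is at
      least \<open>L / 8\<close>, which is \<open>8 * L / 64\<close>; this explains the constant
      \<open>1 / 64\<close>.\<close>
    define L where "L = b + 6"
    have "L * 3 \<le> L * (2 * L + 3)" by (intro mult_left_mono) auto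
    with sum_class_size_ge[of L] have "b \<le> order_for L" "order_for L > 0"
      by (auto simp: order_for_def L_def)
    moreover have "real (hom_num (order_for L)) \<le>
        real (order_for L) / 4 - 1 / 64 * ln (ln (real (order_for L)))"
      using hom_num_order_for[of L] ln_ln_order_for[of L] by (simp add: L_def)
    ultimately show "\<exists>n\<ge>b. n \<in> ?N" by blast
  qed
qed simp

end
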